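(* Let $\mathcal{P}$ be a set of primes for which $$\sum_{p\in\mathcal{P}}p^{-1}\le 1+\bigg(1-\sum_{p\in\mathcal{P}}p^{-2}\bigg)^{1/2}.$$ Then for every natural number $k$, the set $\mathbb{N}_k(\mathcal{P})$ is Erdős-best among primitive subsets of $\mathbb{N}_{\ge k}(\mathcal{P})$; that is, for every natural number $k$ and every primitive set $\mathcal{S}\subset\mathbb{N}_{\ge k}(\mathcal{P})$, $$\sum_{n\in\mathcal{S}}\frac{1}{n\log n}\le\sum_{n\in\mathbb{N}_k(\mathcal{P})}\frac{1}{n\log n}.$$
   Context: $\mathbb{N}=\{1,2,3,\dots\}$; natural numbers $k$ satisfy $k\ge1$. For a set $\mathcal{P}$ of primes (finite or infinite), $\mathbb{N}(\mathcal{P})$ is the set of natural numbers all of whose prime factors lie in $\mathcal{P}$. $\Omega(n)$ is the number of prime factors of $n$ counted with multiplicity. $\mathbb{N}_k(\mathcal{P})=\{n\in\mathbb{N}(\mathcal{P}):\Omega(n)=k\}$ and $\mathbb{N}_{\ge k}(\mathcal{P})=\{n\in\mathbb{N}(\mathcal{P}):\Omega(n)\ge k\}$. A nonempty set of natural numbers is called primitive if no element of the set divides another (distinct) element; by convention the singleton $\{1\}$ is not primitive. Sums of nonnegative terms over possibly infinite sets are taken in $[0,\infty]$, so the hypothesis includes that $\sum_{p\in\mathcal{P}}p^{-1}$ converges. The square root is well defined because $\sum_{p}p^{-2}<1$ over all primes. *)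

theory Defs
  imports "HOL-Analysis.Analysis" "HOL-Computational_Algebra.Primes"
begin

definition big_omega :: "nat \<Rightarrow> nat" where
  "big_omega n = size (prime_factorization n)"

text \<open>The natural numbers start at 1 here; \<open>n > 0\<close> excludes 0, whose
  \<^const>\<open>prime_factorization\<close> is empty.\<close>

definition nats_over :: "nat set \<Rightarrow> nat set" where
  "nats_over P = {n. n > 0 \<and> prime_factors n \<subseteq> P}"

definition nats_over_eq :: "nat \<Rightarrow> nat set \<Rightarrow> nat set" where
  "nats_over_eq k P = {n \<in> nats_over P. big_omega n = k}"

definition nats_over_ge :: "nat \<Rightarrow> nat set \<Rightarrow> nat set" where
  "nats_over_ge k P = {n \<in> nats_over P. big_omega n \<ge> k}"

definition primitive_set :: "nat set \<Rightarrow> bool" where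
  "primitive_set S \<longleftrightarrow>
     S \<noteq> {} \<and> 0 \<notin> S \<and> S \<noteq> {1} \<and> (\<forall>m\<in>S. \<forall>n\<in>S. m dvd n \<longrightarrow> m = n)"

text \<open>The sum is taken in \<^typ>\<open>ennreal\<close>, where every family is summable, so the value
  is \<open>\<infinity>\<close> (and not 0) when the real series diverges.\<close>

definition erdos_sum :: "nat set \<Rightarrow> ennreal" where
  "erdos_sum S = (\<Sum>\<^sub>\<infinity>n\<in>S. ennreal (1 / (real n * ln (real n))))"

end

theory Submission
  imports Defs
begin

text \<open>
  Write $f(n) = 1/(n \log n)$ and call $\Omega(n)$ the level of $n$. A finite primitive set above
  level $k$ is pushed down to level $k$ one level at a time: its elements on the highest level
  $m + 1$ are replaced by their shadow, the set of all $n/p$ with $p$ a prime factor of such an $n$.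
  The new set is still an antichain for divisibility, because anything below a shadow element lies
  below an old element, and nothing on the levels up to $m$ lies strictly above a shadow element.
  The theorem therefore reduces to the claim that passing to the shadow of a set of level
  $m + 1 \ge 2$ does not decrease the sum of $f$ (lemma \<open>sum_erdos_weight_le_prime_shadow\<close>).

  The claim is a weighted double count of the pairs $(n, p)$ with $p \mid n$. Listed with
  multiplicity, the $m + 1$ numbers $\log(n/p)$ add up to $m \log n$, so the inequality between
  arithmetic and harmonic means gives
  \[ f(n) \le \frac{m}{(m+1)^2} \sum_{p \mid n} v_p(n) \, \frac{f(n/p)}{p} \]
  (lemma \<open>erdos_weight_le_sum_div_prime\<close>). Summing over $n$ and collecting the terms with the same
  $d = n/p$, each shadow element $d$ receives at most
  \[ \frac{m f(d)}{(m+1)^2} \sum_p \frac{v_p(dp)}{p}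
     \le \frac{m f(d)}{(m+1)^2} \Big( \sum_{p} \frac1p + \frac m2 \Big), \]
  since $v_p(dp) = 1 + v_p(d)$, each $p$ is at least $2$ and the $v_p(d)$ add up to $m$.
  This is at most $f(d)$ once $\sum 1/p \le 7/2$. The hypothesis of the theorem bounds
  $\sum 1/p$ by $2$, as its right-hand side is $1$ plus the square root of a number that is
  at most $1$.

  Infinite primitive sets follow by taking suprema over finite subsets.
\<close>

section \<open>Levels of the divisibility order\<close>

definition erdos_weight :: "nat \<Rightarrow> real" where
  "erdos_weight n = 1 / (real n * ln (real n))"

definition prime_shadow :: "nat set \<Rightarrow> nat set" where
  "prime_shadow A = (\<lambda>(n, p). n div p) ` (SIGMA n:A. prime_factors n)"

lemma big_omega_mult: "m > 0 \<Longrightarrow> n > 0 \<Longrightarrow> big_omega (m * n) = big_omega m + big_omega n"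
  by (simp add: big_omega_def prime_factorization_mult)

lemma big_omega_prime: "prime p \<Longrightarrow> big_omega p = 1"
  by (simp add: big_omega_def prime_factorization_prime)

lemma big_omega_eq_sum: "big_omega n = (\<Sum>p\<in>prime_factors n. multiplicity p n)"
  unfolding big_omega_def size_multiset_overloaded_eq
  by (intro sum.cong) (auto simp: count_prime_factorization_prime in_prime_factors_iff)

lemma ln_eq_sum_prime_factors:
  assumes "n > 0"
  shows "ln (real n) = (\<Sum>p\<in>prime_factors n. real (multiplicity p n) * ln (real p))"
proof -
  have "real n = real (\<Prod>p\<in>prime_factors n. p ^ multiplicity p n)"
    using assms prime_factorization_nat[of n] by simp
  also have "\<dots> = (\<Prod>p\<in>prime_factors n. real p ^ multiplicity p n)"
    by simp
  finally have "ln (real n) = ln (\<Prod>p\<in>prime_factors n. real p ^ multiplicity p n)"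
    by simp
  also have "\<dots> = (\<Sum>p\<in>prime_factors n. ln (real p ^ multiplicity p n))"
    by (rule ln_prod) (auto simp: in_prime_factors_iff prime_gt_0_nat)
  also have "\<dots> = (\<Sum>p\<in>prime_factors n. real (multiplicity p n) * ln (real p))"
    by (rule sum.cong) (auto simp: ln_realpow in_prime_factors_iff prime_gt_0_nat)
  finally show ?thesis .
qed

text \<open>Divisibility between numbers of one level is equality: the cofactor has level 0, hence is 1.\<close>

lemma dvd_big_omega_le_imp_eq:
  assumes "m dvd n" "n > 0" "big_omega n \<le> big_omega m"
  shows "m = n"
proof -
  obtain q where q: "n = m * q" using assms(1) by blast
  with assms(2) have pos: "m > 0" "q > 0" by auto
  have "big_omega q = 0"
    using assms(3) big_omega_mult[OF pos] q by simp
  then have "q = 1"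
    using pos by (auto simp: big_omega_def prime_factorization_empty_iff)
  with q show ?thesis by simp
qed

lemma big_omega_pos_imp_gt_1:
  assumes "big_omega n \<ge> 1" "n > 0"
  shows "n > 1"
proof (rule ccontr)
  assume "\<not> n > 1"
  with assms(2) have "n = 1" by simp
  with assms(1) show False by (simp add: big_omega_def)
qed

lemma erdos_weight_nonneg: "erdos_weight n \<ge> 0"
  by (cases "n = 0") (auto simp: erdos_weight_def)

lemma nats_over_div_prime:
  assumes "n \<in> nats_over_eq (Suc m) P" "p \<in> prime_factors n"
  shows "n div p \<in> nats_over_eq m P" "n = n div p * p"
proof -
  have p: "prime p" "p dvd n" and n: "n > 0" "prime_factors n \<subseteq> P" "big_omega n = Suc m"
    using assms by (auto simp: nats_over_eq_def nats_over_def in_prime_factors_iff)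
  show eq: "n = n div p * p" using p by simp
  have pos: "n div p > 0" using eq n(1) by (metis gr0I mult_zero_left less_irrefl)
  have "big_omega n = big_omega (n div p) + 1"
    using big_omega_mult[of "n div p" p] big_omega_prime[OF p(1)] pos prime_gt_0_nat[OF p(1)] eq
    by simp
  moreover have "prime_factors (n div p) \<subseteq> prime_factors n"
    by (rule dvd_prime_factors) (use n p in \<open>auto simp: div_dvd_iff_mult\<close>)
  ultimately show "n div p \<in> nats_over_eq m P"
    using n pos by (auto simp: nats_over_eq_def nats_over_def)
qed

lemma prime_shadow_subset:
  assumes "A \<subseteq> nats_over_eq (Suc m) P"
  shows "prime_shadow A \<subseteq> nats_over_eq m P"
proof
  fix d assume "d \<in> prime_shadow A"
  then obtain n p where "n \<in> A" "p \<in> prime_factors n" "d = n div p"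
    by (auto simp: prime_shadow_def)
  then show "d \<in> nats_over_eq m P"
    using assms nats_over_div_prime(1)[of n m P p] by auto
qed

section \<open>The shadow inequality\<close>

text \<open>
  The inequality of arithmetic and harmonic means for the $m + 1$ numbers $y_p = \log(n/p)$ (with
  multiplicity), whose mean is $c = m \log n / (m + 1)$. It is proved by replacing the convex
  function $1/y$ by its tangent $2/c - y/c^2$ at $c$; as the tangent is linear in $y$, only
  \<open>\<Sum> v\<^sub>p(n) = m + 1\<close> and \<open>\<Sum> v\<^sub>p(n) log p = log n\<close> are needed to sum it.
\<close>

lemma erdos_weight_le_sum_div_prime:
  assumes n: "n > 0" "big_omega n = Suc m" and m: "m \<ge> 1"
  shows "erdos_weight n \<le> real m / (real m + 1)\<^sup>2 *
    (\<Sum>p\<in>prime_factors n. real (multiplicity p n) * (erdos_weight (n div p) / real p))"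
proof -
  define L where "L = ln (real n)"
  define c where "c = real m * L / (real m + 1)"
  have "n > 1" using big_omega_pos_imp_gt_1 n by simp
  then have L: "L > 0" by (simp add: L_def)
  have c: "c > 0" using L m by (simp add: c_def)
  have tangent: "2 / c - (L - ln (real p)) / c\<^sup>2 \<le> real n * (erdos_weight (n div p) / real p)"
    if "p \<in> prime_factors n" for p
  proof -
    define y where "y = ln (real (n div p))"
    have d: "n div p \<in> nats_over_eq m UNIV" "n = n div p * p"
      using nats_over_div_prime[of n m UNIV p] that n
      by (auto simp: nats_over_eq_def nats_over_def)
    then have gt: "n div p > 1" using big_omega_pos_imp_gt_1[of "n div p"] m
      by (auto simp: nats_over_eq_def nats_over_def)
    have p: "p > 0" using that by (auto simp: in_prime_factors_iff prime_gt_0_nat)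
    have eq: "real n = real (n div p) * real p"
      using d(2) of_nat_mult by metis
    have y: "y > 0" using gt by (simp add: y_def)
    have "L = y + ln (real p)"
      unfolding L_def y_def eq using gt p by (subst ln_mult) auto
    moreover have "real n * (erdos_weight (n div p) / real p) = 1 / y"
      unfolding erdos_weight_def y_def[symmetric] using eq gt p y by (simp add: field_simps)
    moreover have "2 / c - y / c\<^sup>2 \<le> 1 / y"
    proof -
      have "1 / y - (2 / c - y / c\<^sup>2) = (c - y)\<^sup>2 / (y * c\<^sup>2)"
        using y c by (simp add: field_simps power2_eq_square)
      also have "\<dots> \<ge> 0" using y by simp
      finally show ?thesis by simp
    qed
    ultimately show ?thesis by simp
  qed
  have om: "(\<Sum>p\<in>prime_factors n. real (multiplicity p n)) = real m + 1"
    using n(2) big_omega_eq_sum[of n] by (metis of_nat_Suc of_nat_sum add.commute)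
  have "(real m + 1)\<^sup>2 / (real m * L) = (real m + 1) * (2 / c - L / c\<^sup>2) + L / c\<^sup>2"
    using L m by (simp add: c_def field_simps power2_eq_square)
  also have "\<dots> = (\<Sum>p\<in>prime_factors n. real (multiplicity p n)) * (2 / c - L / c\<^sup>2)
      + (\<Sum>p\<in>prime_factors n. real (multiplicity p n) * ln (real p)) / c\<^sup>2"
    using om ln_eq_sum_prime_factors[OF n(1)] by (simp add: L_def)
  also have "\<dots> = (\<Sum>p\<in>prime_factors n. real (multiplicity p n) * (2 / c - (L - ln (real p)) / c\<^sup>2))"
    unfolding sum_distrib_right sum_divide_distrib sum.distrib[symmetric]
    by (intro sum.cong refl) (simp add: diff_divide_distrib algebra_simps)
  also have "\<dots> \<le> (\<Sum>p\<in>prime_factors n.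
      real (multiplicity p n) * (real n * (erdos_weight (n div p) / real p)))"
    by (intro sum_mono mult_left_mono tangent) auto
  also have "\<dots> = real n * (\<Sum>p\<in>prime_factors n.
      real (multiplicity p n) * (erdos_weight (n div p) / real p))"
    by (simp add: sum_distrib_left mult_ac)
  finally have "(real m + 1)\<^sup>2 / (real m * L) \<le> real n * (\<Sum>p\<in>prime_factors n.
      real (multiplicity p n) * (erdos_weight (n div p) / real p))" (is "_ \<le> real n * ?R") .
  then have "real m / (real m + 1)\<^sup>2 / real n * ((real m + 1)\<^sup>2 / (real m * L))
      \<le> real m / (real m + 1)\<^sup>2 / real n * (real n * ?R)"
    by (intro mult_left_mono) auto
  moreover have "real m / (real m + 1)\<^sup>2 / real n * ((real m + 1)\<^sup>2 / (real m * L)) = erdos_weight n"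
    using m by (simp add: erdos_weight_def L_def)
  moreover have "real m / (real m + 1)\<^sup>2 / real n * (real n * ?R) = real m / (real m + 1)\<^sup>2 * ?R"
    using n by simp
  ultimately show ?thesis by simp
qed

lemma sum_multiplicity_div_prime_le:
  assumes Q: "finite Q" "\<And>p. p \<in> Q \<Longrightarrow> prime p"
  shows "(\<Sum>p\<in>Q. real (multiplicity p d) / real p) \<le> real (big_omega d) / 2"
proof -
  have "(\<Sum>p\<in>Q. real (multiplicity p d) / real p) \<le> (\<Sum>p\<in>Q. real (multiplicity p d) / 2)"
    using Q(2) by (intro sum_mono divide_left_mono) (auto dest: prime_ge_2_nat prime_gt_0_nat)
  also have "\<dots> = (\<Sum>p\<in>Q \<inter> prime_factors d. real (multiplicity p d) / 2)"
    using Q by (intro sum.mono_neutral_right) (auto simp: prime_factors_multiplicity)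
  also have "\<dots> \<le> (\<Sum>p\<in>prime_factors d. real (multiplicity p d) / 2)"
    by (intro sum_mono2) auto
  also have "\<dots> = real (big_omega d) / 2"
    by (simp add: big_omega_eq_sum sum_divide_distrib)
  finally show ?thesis .
qed

text \<open>
  Every edge $n \mapsto n/p = d$ carries the amount $v_p(n) f(d)/p$, scaled by $r = m/(m+1)^2$. The
  previous inequality says that what leaves $n$ is at least $f(n)$; what arrives at $d$ is at most
  $r (7/2 + m/2) f(d)$. The constant $7/2$ is the largest for which $r (7/2 + m/2) \le 1$ for all
  integers $m \ge 1$: this reads $(m - 1)(m - 2) \ge 0$, with equality at $m = 1$ and $m = 2$.
\<close>

lemma sum_erdos_weight_le_prime_shadow:
  assumes A: "finite A" "A \<subseteq> nats_over_eq (Suc m) P" and m: "m \<ge> 1"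
    and recip: "\<And>Q. finite Q \<Longrightarrow> Q \<subseteq> P \<Longrightarrow> (\<Sum>p\<in>Q. 1 / real p) \<le> 7 / 2"
  shows "(\<Sum>n\<in>A. erdos_weight n) \<le> (\<Sum>d\<in>prime_shadow A. erdos_weight d)"
proof -
  define Q where "Q = (\<Union>n\<in>A. prime_factors n)"
  define r where "r = real m / (real m + 1)\<^sup>2"
  define h where "h d p = real (multiplicity p (d * p)) * (erdos_weight d / real p)" for d p
  have Q: "finite Q" "Q \<subseteq> P" "\<And>p. p \<in> Q \<Longrightarrow> prime p"
    using A by (auto simp: Q_def nats_over_eq_def nats_over_def in_prime_factors_iff)
  have fin: "finite (prime_shadow A)"
    using A(1) by (auto simp: prime_shadow_def)
  have h_nonneg: "h d p \<ge> 0" for d p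
    by (simp add: h_def erdos_weight_nonneg)
  have shadow: "prime_shadow A \<subseteq> nats_over_eq m P"
    using A(2) by (rule prime_shadow_subset)
  have undiv: "n div p * p = n" if "n \<in> A" "p \<in> prime_factors n" for n p
    using nats_over_div_prime(2)[of n m P p] that A(2) by auto
  have fibre: "r * (\<Sum>p\<in>Q. h d p) \<le> erdos_weight d" if "d \<in> prime_shadow A" for d
  proof -
    have d: "big_omega d = m" "d > 0"
      using that shadow by (auto simp: nats_over_eq_def nats_over_def)
    have "(\<Sum>p\<in>Q. h d p) = (\<Sum>p\<in>Q. erdos_weight d * (1 / real p + real (multiplicity p d) / real p))"
    proof (rule sum.cong[OF refl])
      fix p assume "p \<in> Q"
      with Q(3) have p: "prime p" by blast
      have "multiplicity p (d * p) = Suc (multiplicity p d)"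
        unfolding mult.commute[of d p] using p d(2)
        by (intro multiplicity_times_same) (auto simp: prime_gt_0_nat)
      then show "h d p = erdos_weight d * (1 / real p + real (multiplicity p d) / real p)"
        by (simp add: h_def add_divide_distrib algebra_simps)
    qed
    also have "\<dots> = erdos_weight d * ((\<Sum>p\<in>Q. 1 / real p) + (\<Sum>p\<in>Q. real (multiplicity p d) / real p))"
      by (simp only: sum_distrib_left[symmetric] sum.distrib)
    also have "\<dots> \<le> erdos_weight d * (7 / 2 + real m / 2)"
      using recip[OF Q(1,2)] sum_multiplicity_div_prime_le[OF Q(1,3), of d] d
      by (intro mult_left_mono erdos_weight_nonneg) auto
    finally have "r * (\<Sum>p\<in>Q. h d p) \<le> r * (erdos_weight d * (7 / 2 + real m / 2))"
      by (intro mult_left_mono) (auto simp: r_def)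
    also have "\<dots> = (r * (7 / 2 + real m / 2)) * erdos_weight d" by simp
    also have "\<dots> \<le> 1 * erdos_weight d"
    proof (intro mult_right_mono erdos_weight_nonneg)
      (* No integer lies strictly between the roots 1 and 2 of the quadratic. *)
      have "(real m - 1) * (real m - 2) \<ge> 0"
      proof (cases "m = 1")
        case False
        with m have "real m \<ge> 2" by simp
        then show ?thesis by simp
      qed simp
      then have "real m * (7 / 2 + real m / 2) \<le> (real m + 1)\<^sup>2"
        by (simp add: power2_eq_square algebra_simps)
      then show "r * (7 / 2 + real m / 2) \<le> 1"
        by (simp add: r_def)
    qed
    finally show ?thesis by simp
  qed
  have "(\<Sum>n\<in>A. \<Sum>p\<in>prime_factors n. h (n div p) p)
      = (\<Sum>(n, p)\<in>(SIGMA n:A. prime_factors n). h (n div p) p)"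
    using A(1) by (simp add: sum.Sigma)
  also have "\<dots> = (\<Sum>(d, p)\<in>(\<lambda>(n, p). (n div p, p)) ` (SIGMA n:A. prime_factors n). h d p)"
  proof (subst sum.reindex)
    show "inj_on (\<lambda>(n, p). (n div p, p)) (SIGMA n:A. prime_factors n)"
      by (rule inj_on_inverseI[where g = "\<lambda>(d, p). (d * p, p)"]) (use undiv in auto)
  qed (simp add: case_prod_unfold)
  also have "\<dots> \<le> (\<Sum>(d, p)\<in>prime_shadow A \<times> Q. h d p)"
    using Q(1) fin h_nonneg by (intro sum_mono2) (auto simp: prime_shadow_def Q_def image_iff)
  also have "\<dots> = (\<Sum>d\<in>prime_shadow A. \<Sum>p\<in>Q. h d p)"
    by (simp add: sum.cartesian_product)
  finally have regroup: "(\<Sum>n\<in>A. \<Sum>p\<in>prime_factors n. h (n div p) p)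
      \<le> (\<Sum>d\<in>prime_shadow A. \<Sum>p\<in>Q. h d p)" .
  have "(\<Sum>n\<in>A. erdos_weight n) \<le> (\<Sum>n\<in>A. r * (\<Sum>p\<in>prime_factors n.
      real (multiplicity p n) * (erdos_weight (n div p) / real p)))"
    unfolding r_def using A(2) m
    by (intro sum_mono erdos_weight_le_sum_div_prime) (auto simp: nats_over_eq_def nats_over_def)
  also have "\<dots> = r * (\<Sum>n\<in>A. \<Sum>p\<in>prime_factors n. h (n div p) p)"
    unfolding sum_distrib_left[symmetric]
    by (intro arg_cong2[where f = "(*)"] sum.cong refl) (simp add: h_def undiv)
  also have "\<dots> \<le> r * (\<Sum>d\<in>prime_shadow A. \<Sum>p\<in>Q. h d p)"
    by (intro mult_left_mono regroup) (simp add: r_def)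
  also have "\<dots> = (\<Sum>d\<in>prime_shadow A. r * (\<Sum>p\<in>Q. h d p))"
    by (simp add: sum_distrib_left)
  also have "\<dots> \<le> (\<Sum>d\<in>prime_shadow A. erdos_weight d)"
    by (intro sum_mono fibre)
  finally show ?thesis .
qed

section \<open>Pushing an antichain down to its lowest level\<close>

text \<open>
  Induction on the number $j$ of levels above $k$ that the antichain may occupy: the part \<open>A\<close> on
  the highest level is exchanged for its shadow. As the shadow inequality starts at level 1,
  the induction needs $k \ge 1$.
\<close>

lemma finite_antichain_sum_le_level:
  assumes k: "k \<ge> 1"
    and recip: "\<And>Q. finite Q \<Longrightarrow> Q \<subseteq> P \<Longrightarrow> (\<Sum>p\<in>Q. 1 / real p) \<le> 7 / 2"
    and "finite S" "S \<subseteq> nats_over_ge k P" "\<And>n. n \<in> S \<Longrightarrow> big_omega n \<le> k + j"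
    and "\<And>m n. m \<in> S \<Longrightarrow> n \<in> S \<Longrightarrow> m dvd n \<Longrightarrow> m = n"
  shows "\<exists>T. finite T \<and> T \<subseteq> nats_over_eq k P \<and> (\<Sum>n\<in>S. erdos_weight n) \<le> (\<Sum>n\<in>T. erdos_weight n)"
  using assms(3-)
proof (induction j arbitrary: S)
  case 0
  then have "S \<subseteq> nats_over_eq k P"
    by (fastforce simp: nats_over_eq_def nats_over_ge_def)
  with 0 show ?case by blast
next
  case (Suc j)
  define A where "A = {n \<in> S. big_omega n = Suc (k + j)}"
  define D where "D = prime_shadow A"
  define B where "B = S - A"
  have A: "finite A" "A \<subseteq> nats_over_eq (Suc (k + j)) P" "A \<subseteq> S"
    using Suc.prems by (auto simp: A_def nats_over_eq_def nats_over_ge_def)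
  have B: "finite B" "B \<subseteq> S" using Suc.prems by (auto simp: B_def)
  have B_omega: "big_omega n \<le> k + j" if "n \<in> B" for n
    using that Suc.prems(3)[of n] by (auto simp: B_def A_def le_Suc_eq)
  have D_cover: "\<exists>n\<in>A. d dvd n" if "d \<in> D" for d
  proof -
    from that obtain n p where "n \<in> A" "p \<in> prime_factors n" "d = n div p"
      by (auto simp: D_def prime_shadow_def)
    moreover from this have "n = n div p * p"
      using nats_over_div_prime(2)[of n "k + j" P p] A(2) by blast
    ultimately show ?thesis
      by (metis dvd_triv_left)
  qed
  have D_level: "D \<subseteq> nats_over_eq (k + j) P"
    unfolding D_def using A(2) by (rule prime_shadow_subset)
  have D: "finite D" using A(1) by (auto simp: D_def prime_shadow_def)
  have no_below: "\<not> s dvd d" if "s \<in> B" "d \<in> D" for s d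
  proof
    assume "s dvd d"
    with D_cover[OF that(2)] obtain n where "n \<in> A" "s dvd n" by (meson dvd_trans)
    with Suc.prems(4)[of s n] that(1) A(3) B_def show False by auto
  qed
  have no_above: "\<not> d dvd s" if "s \<in> B" "d \<in> D" for s d
  proof
    assume "d dvd s"
    moreover have "s > 0" using that(1) B(2) Suc.prems(2) by (auto simp: nats_over_ge_def nats_over_def)
    moreover have "big_omega d = k + j" using that(2) D_level by (auto simp: nats_over_eq_def)
    ultimately have "d = s" using dvd_big_omega_le_imp_eq B_omega[OF that(1)] by simp
    with no_below[OF that] show False by simp
  qed
  have antichain: "m = n" if mn: "m \<in> B \<union> D" "n \<in> B \<union> D" "m dvd n" for m n
  proof -
    consider "m \<in> B" "n \<in> B" | "m \<in> D" "n \<in> D"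
      using mn no_below no_above by (metis UnE)
    then show ?thesis
    proof cases
      case 1 then show ?thesis using mn(3) Suc.prems(4) B(2) by blast
    next
      case 2
      then have "m \<in> nats_over_eq (k + j) P" "n \<in> nats_over_eq (k + j) P"
        using D_level by auto
      then show ?thesis using mn(3)
        by (intro dvd_big_omega_le_imp_eq) (auto simp: nats_over_eq_def nats_over_def)
    qed
  qed
  have "(\<Sum>n\<in>S. erdos_weight n) = (\<Sum>n\<in>B. erdos_weight n) + (\<Sum>n\<in>A. erdos_weight n)"
    using Suc.prems(1) A(3) by (simp add: B_def sum.subset_diff)
  also have "\<dots> \<le> (\<Sum>n\<in>B. erdos_weight n) + (\<Sum>n\<in>D. erdos_weight n)"
    unfolding D_def using sum_erdos_weight_le_prime_shadow[OF A(1,2) _ recip] k by simp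
  also have "\<dots> = (\<Sum>n\<in>B \<union> D. erdos_weight n)"
  proof (rule sum.union_disjoint[symmetric])
    show "B \<inter> D = {}" using no_below dvd_refl by blast
  qed (use B(1) D in auto)
  finally have le: "(\<Sum>n\<in>S. erdos_weight n) \<le> (\<Sum>n\<in>B \<union> D. erdos_weight n)" .
  have "\<exists>T. finite T \<and> T \<subseteq> nats_over_eq k P
      \<and> (\<Sum>n\<in>B \<union> D. erdos_weight n) \<le> (\<Sum>n\<in>T. erdos_weight n)"
  proof (rule Suc.IH)
    show "B \<union> D \<subseteq> nats_over_ge k P"
      using B(2) Suc.prems(2) D_level by (auto simp: nats_over_eq_def nats_over_ge_def)
    show "big_omega n \<le> k + j" if "n \<in> B \<union> D" for n
      using that B_omega D_level by (auto simp: nats_over_eq_def)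
  qed (use B(1) D antichain in auto)
  with le show ?case by (meson order_trans)
qed

lemma erdos_sum_eq_SUP:
  "erdos_sum S = (SUP F\<in>{F. finite F \<and> F \<subseteq> S}. ennreal (\<Sum>n\<in>F. erdos_weight n))"
  unfolding erdos_sum_def erdos_weight_def[symmetric]
  by (subst nonneg_infsum_complete) (simp_all add: erdos_weight_nonneg)

theorem theorem5:
  fixes P :: "nat set"
  assumes "\<And>p. p \<in> P \<Longrightarrow> prime p"
    and "(\<Sum>\<^sub>\<infinity>p\<in>P. ennreal (1 / real p))
           \<le> ennreal (1 + sqrt (1 - (\<Sum>\<^sub>\<infinity>p\<in>P. 1 / (real p)\<^sup>2)))"
  shows "\<forall>k::nat. k \<ge> 1 \<longrightarrow>
           (\<forall>S. primitive_set S \<and> S \<subseteq> nats_over_ge k P \<longrightarrow>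
              erdos_sum S \<le> erdos_sum (nats_over_eq k P))"
proof (intro allI impI, elim conjE)
  fix k :: nat and S
  assume k: "k \<ge> 1" and S: "primitive_set S" "S \<subseteq> nats_over_ge k P"
  have "(\<Sum>\<^sub>\<infinity>p\<in>P. 1 / (real p)\<^sup>2) \<ge> 0"
    by (intro infsum_nonneg) simp
  then have "sqrt (1 - (\<Sum>\<^sub>\<infinity>p\<in>P. 1 / (real p)\<^sup>2)) \<le> 1"
    by simp
  then have "ennreal (1 + sqrt (1 - (\<Sum>\<^sub>\<infinity>p\<in>P. 1 / (real p)\<^sup>2))) \<le> ennreal (7 / 2)"
    by (intro ennreal_leI) linarith
  with assms(2) have total: "(\<Sum>\<^sub>\<infinity>p\<in>P. ennreal (1 / real p)) \<le> ennreal (7 / 2)"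
    by (rule order_trans)
  have recip: "(\<Sum>p\<in>Q. 1 / real p) \<le> 7 / 2" if "finite Q" "Q \<subseteq> P" for Q
  proof -
    have "ennreal (\<Sum>p\<in>Q. 1 / real p) = (\<Sum>p\<in>Q. ennreal (1 / real p))"
      by simp
    also have "\<dots> \<le> (\<Sum>\<^sub>\<infinity>p\<in>P. ennreal (1 / real p))"
      using that by (subst nonneg_infsum_complete) (auto intro: SUP_upper)
    finally have "ennreal (\<Sum>p\<in>Q. 1 / real p) \<le> ennreal (7 / 2)"
      using total by (rule order_trans)
    then show ?thesis by (simp add: ennreal_le_iff)
  qed
  show "erdos_sum S \<le> erdos_sum (nats_over_eq k P)"
    unfolding erdos_sum_eq_SUP[of S]
  proof (rule SUP_least, clarify)
    fix F assume F: "finite F" "F \<subseteq> S"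
    (* A crude bound for the levels that occur in F; any finite one would do. *)
    define j where "j = (\<Sum>n\<in>F. big_omega n)"
    have "\<exists>T. finite T \<and> T \<subseteq> nats_over_eq k P
        \<and> (\<Sum>n\<in>F. erdos_weight n) \<le> (\<Sum>n\<in>T. erdos_weight n)"
    proof (rule finite_antichain_sum_le_level[where j = j])
      show "big_omega n \<le> k + j" if "n \<in> F" for n
        unfolding j_def using that F(1) member_le_sum[of n F big_omega] by simp
      show "m = n" if "m \<in> F" "n \<in> F" "m dvd n" for m n
        using that F(2) S(1) by (auto simp: primitive_set_def)
    qed (use k recip F S(2) in auto)
    then obtain T where T: "finite T" "T \<subseteq> nats_over_eq k P"
      "(\<Sum>n\<in>F. erdos_weight n) \<le> (\<Sum>n\<in>T. erdos_weight n)" by blast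
    have "ennreal (\<Sum>n\<in>F. erdos_weight n) \<le> ennreal (\<Sum>n\<in>T. erdos_weight n)"
      using T(3) by (rule ennreal_leI)
    also have "\<dots> \<le> erdos_sum (nats_over_eq k P)"
      unfolding erdos_sum_eq_SUP using T by (intro SUP_upper) auto
    finally show "ennreal (\<Sum>n\<in>F. erdos_weight n) \<le> erdos_sum (nats_over_eq k P)" .
  qed
qed

end
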